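(* Let $(\mathcal{C},\otimes,\alpha)$ be a skew semimonoidal category. Any two objects $(I,\lambda,\rho)$ and $(J,\lambda',\rho')$ of its category of units $\mathcal{U}(\mathcal{C})$ are isomorphic in $\mathcal{U}(\mathcal{C})$.
   Context: A skew semimonoidal category $(\mathcal{C},\otimes,\alpha)$ is a category $\mathcal{C}$ with a functor $\otimes:\mathcal{C}\times\mathcal{C}\to\mathcal{C}$ and a natural transformation (not assumed invertible) with components $\alpha_{X,Y,Z}:(X\otimes Y)\otimes Z\to X\otimes(Y\otimes Z)$ such that for all $W,X,Y,Z$ $$\alpha_{W,X,Y\otimes Z}\circ\alpha_{W\otimes X,Y,Z}=(1_W\otimes\alpha_{X,Y,Z})\circ\alpha_{W,X\otimes Y,Z}\circ(\alpha_{W,X,Y}\otimes 1_Z).$$ The category of units $\mathcal{U}(\mathcal{C})$ has as objects the triples $(I,\lambda,\rho)$ where $I$ is an object of $\mathcal{C}$ and $\lambda_X:I\otimes X\to X$, $\rho_X:X\to X\otimes I$ are natural families of morphisms (not assumed invertible) such that for all $X,Y$: - $\lambda_{X\otimes Y}\circ\alpha_{I,X,Y}=\lambda_X\otimes 1_Y$; - $(1_X\otimes\lambda_Y)\circ\alpha_{X,I,Y}\circ(\rho_X\otimes 1_Y)=1_{X\otimes Y}$; - $\alpha_{X,Y,I}\circ\rho_{X\otimes Y}=1_X\otimes\rho_Y$; - $\lambda_I\circ\rho_I=1_I$. A morphism $(I,\lambda,\rho)\to(J,\lambda',\rho')$ in $\mathcal{U}(\mathcal{C})$ is a morphism $\varphi:I\to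 J$ of $\mathcal{C}$ such that for all $X$: $\lambda'_X\circ(\varphi\otimes 1_X)=\lambda_X$ and $(1_X\otimes\varphi)\circ\rho_X=\rho'_X$. Composition is that of $\mathcal{C}$. *)

theory Defs
  imports Main "HOL-Library.FuncSet"
begin

record ('o, 'm) cat =
  Obj :: "'o set"
  Arr :: "'m set"
  Dom :: "'m \<Rightarrow> 'o"
  Cod :: "'m \<Rightarrow> 'o"
  Ident :: "'o \<Rightarrow> 'm" ("\<one>\<index>")
  Comp :: "'m \<Rightarrow> 'm \<Rightarrow> 'm" (infixl "\<cdot>\<index>" 55)

text \<open>Composition is written in the classical order: \<open>g \<cdot> f\<close> is meaningful for \<open>Cod f = Dom g\<close>.\<close>

definition homs :: "('o, 'm) cat \<Rightarrow> 'o \<Rightarrow> 'o \<Rightarrow> 'm set" where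
  "homs C x y = {f \<in> Arr C. Dom C f = x \<and> Cod C f = y}"

locale category =
  fixes C :: "('o, 'm) cat" (structure)
  assumes Dom_in_Obj: "f \<in> Arr C \<Longrightarrow> Dom C f \<in> Obj C"
    and Cod_in_Obj: "f \<in> Arr C \<Longrightarrow> Cod C f \<in> Obj C"
    and Ident_in_homs: "x \<in> Obj C \<Longrightarrow> \<one> x \<in> homs C x x"
    and Comp_in_homs: "\<lbrakk>f \<in> homs C x y; g \<in> homs C y z\<rbrakk> \<Longrightarrow> g \<cdot> f \<in> homs C x z"
    and Comp_Ident: "f \<in> homs C x y \<Longrightarrow> f \<cdot> \<one> x = f"
    and Ident_Comp: "f \<in> homs C x y \<Longrightarrow> \<one> y \<cdot> f = f"
    and Comp_assoc:
      "\<lbrakk>f \<in> homs C w x; g \<in> homs C x y; h \<in> homs C y z\<rbrakk> \<Longrightarrow> (h \<cdot> g) \<cdot> f = h \<cdot> (g \<cdot> f)"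

definition isomorphic_in :: "('o, 'm) cat \<Rightarrow> 'o \<Rightarrow> 'o \<Rightarrow> bool" where
  "isomorphic_in C x y \<longleftrightarrow>
     (\<exists>f \<in> homs C x y. \<exists>g \<in> homs C y x. g \<cdot>\<^bsub>C\<^esub> f = \<one>\<^bsub>C\<^esub> x \<and> f \<cdot>\<^bsub>C\<^esub> g = \<one>\<^bsub>C\<^esub> y)"

definition prod_cat :: "('o, 'm) cat \<Rightarrow> ('p, 'n) cat \<Rightarrow> ('o \<times> 'p, 'm \<times> 'n) cat" where
  "prod_cat C D =
     \<lparr>Obj = Obj C \<times> Obj D,
      Arr = Arr C \<times> Arr D,
      Dom = map_prod (Dom C) (Dom D),
      Cod = map_prod (Cod C) (Cod D),
      Ident = map_prod (Ident C) (Ident D),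
      Comp = (\<lambda>(g, g') (f, f'). (g \<cdot>\<^bsub>C\<^esub> f, g' \<cdot>\<^bsub>D\<^esub> f'))\<rparr>"

record ('o, 'm, 'p, 'n) fctr =
  omap :: "'o \<Rightarrow> 'p"
  amap :: "'m \<Rightarrow> 'n"

locale is_functor =
  dom: category C + cod: category D
  for C :: "('o, 'm) cat" and D :: "('p, 'n) cat" +
  fixes F :: "('o, 'm, 'p, 'n) fctr"
  assumes omap_in_Obj: "x \<in> Obj C \<Longrightarrow> omap F x \<in> Obj D"
    and amap_in_homs: "f \<in> homs C x y \<Longrightarrow> amap F f \<in> homs D (omap F x) (omap F y)"
    and amap_Ident: "x \<in> Obj C \<Longrightarrow> amap F (\<one>\<^bsub>C\<^esub> x) = \<one>\<^bsub>D\<^esub> (omap F x)"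
    and amap_Comp:
      "\<lbrakk>f \<in> homs C x y; g \<in> homs C y z\<rbrakk> \<Longrightarrow> amap F (g \<cdot>\<^bsub>C\<^esub> f) = amap F g \<cdot>\<^bsub>D\<^esub> amap F f"

definition id_functor :: "('o, 'm, 'o, 'm) fctr" where
  "id_functor = \<lparr>omap = (\<lambda>x. x), amap = (\<lambda>f. f)\<rparr>"

locale natural_transformation =
  source: is_functor C D F + target: is_functor C D G
  for C :: "('o, 'm) cat" and D :: "('p, 'n) cat"
    and F G :: "('o, 'm, 'p, 'n) fctr" +
  fixes \<tau> :: "'o \<Rightarrow> 'n"
  assumes component_in_homs: "x \<in> Obj C \<Longrightarrow> \<tau> x \<in> homs D (omap F x) (omap G x)"
    and naturality:
      "f \<in> homs C x y \<Longrightarrow> \<tau> y \<cdot>\<^bsub>D\<^esub> amap F f = amap G f \<cdot>\<^bsub>D\<^esub> \<tau> x"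

locale category_with_tensor =
  category C + tensor: is_functor "prod_cat C C" C T
  for C :: "('o, 'm) cat" (structure)
    and T :: "('o \<times> 'o, 'm \<times> 'm, 'o, 'm) fctr"
begin

abbreviation tensor_obj :: "'o \<Rightarrow> 'o \<Rightarrow> 'o" (infixr "\<otimes>" 70) where
  "X \<otimes> Y \<equiv> omap T (X, Y)"

abbreviation tensor_arr :: "'m \<Rightarrow> 'm \<Rightarrow> 'm" (infixr "\<boxtimes>" 70) where
  "f \<boxtimes> g \<equiv> amap T (f, g)"

end

text \<open>The associator is not assumed to be invertible, nor are the unit constraints below.\<close>

locale skew_semimonoidal_category = category_with_tensor C T
  for C :: "('o, 'm) cat" (structure)
    and T :: "('o \<times> 'o, 'm \<times> 'm, 'o, 'm) fctr" +
  fixes \<alpha> :: "'o \<Rightarrow> 'o \<Rightarrow> 'o \<Rightarrow> 'm"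
  assumes associator_natural:
    "natural_transformation (prod_cat (prod_cat C C) C) C
       \<lparr>omap = (\<lambda>((X, Y), Z). (X \<otimes> Y) \<otimes> Z), amap = (\<lambda>((f, g), h). (f \<boxtimes> g) \<boxtimes> h)\<rparr>
       \<lparr>omap = (\<lambda>((X, Y), Z). X \<otimes> (Y \<otimes> Z)), amap = (\<lambda>((f, g), h). f \<boxtimes> (g \<boxtimes> h))\<rparr>
       (\<lambda>((X, Y), Z). \<alpha> X Y Z)"
    and pentagon:
    "\<lbrakk>W \<in> Obj C; X \<in> Obj C; Y \<in> Obj C; Z \<in> Obj C\<rbrakk> \<Longrightarrow>
       \<alpha> W X (Y \<otimes> Z) \<cdot> \<alpha> (W \<otimes> X) Y Z =
       (\<one> W \<boxtimes> \<alpha> X Y Z) \<cdot> \<alpha> W (X \<otimes> Y) Z \<cdot> (\<alpha> W X Y \<boxtimes> \<one> Z)"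

text \<open>
  The families \<open>l\<close> and \<open>r\<close> are indexed by the objects of \<open>C\<close>, but HOL functions are total; the
  extensionality conditions fix their values outside \<open>Obj C\<close>, so that two units are
  equal as soon as their components agree at every object.
\<close>

locale skew_unit = skew_semimonoidal_category C T \<alpha>
  for C :: "('o, 'm) cat" (structure)
    and T :: "('o \<times> 'o, 'm \<times> 'm, 'o, 'm) fctr"
    and \<alpha> :: "'o \<Rightarrow> 'o \<Rightarrow> 'o \<Rightarrow> 'm" +
  fixes I :: 'o and l r :: "'o \<Rightarrow> 'm"
  assumes unit_in_Obj: "I \<in> Obj C"
    and l_extensional: "l \<in> extensional (Obj C)"
    and r_extensional: "r \<in> extensional (Obj C)"
    and l_natural:
      "natural_transformation C C \<lparr>omap = (\<lambda>X. I \<otimes> X), amap = (\<lambda>f. \<one> I \<boxtimes> f)\<rparr> id_functor l"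
    and r_natural:
      "natural_transformation C C id_functor \<lparr>omap = (\<lambda>X. X \<otimes> I), amap = (\<lambda>f. f \<boxtimes> \<one> I)\<rparr> r"
    and l_tensor:
      "\<lbrakk>X \<in> Obj C; Y \<in> Obj C\<rbrakk> \<Longrightarrow> l (X \<otimes> Y) \<cdot> \<alpha> I X Y = l X \<boxtimes> \<one> Y"
    and triangle:
      "\<lbrakk>X \<in> Obj C; Y \<in> Obj C\<rbrakk> \<Longrightarrow>
         (\<one> X \<boxtimes> l Y) \<cdot> \<alpha> X I Y \<cdot> (r X \<boxtimes> \<one> Y) = \<one> (X \<otimes> Y)"
    and r_tensor:
      "\<lbrakk>X \<in> Obj C; Y \<in> Obj C\<rbrakk> \<Longrightarrow> \<alpha> X Y I \<cdot> r (X \<otimes> Y) = \<one> X \<boxtimes> r Y"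
    and l_r_unit: "l I \<cdot> r I = \<one> I"

locale unit_morphism =
  source: skew_unit C T \<alpha> I l r + target: skew_unit C T \<alpha> J l' r'
  for C :: "('o, 'm) cat" (structure)
    and T :: "('o \<times> 'o, 'm \<times> 'm, 'o, 'm) fctr"
    and \<alpha> :: "'o \<Rightarrow> 'o \<Rightarrow> 'o \<Rightarrow> 'm"
    and I :: 'o and l r :: "'o \<Rightarrow> 'm" and J :: 'o and l' r' :: "'o \<Rightarrow> 'm" +
  fixes \<phi> :: 'm
  assumes in_homs: "\<phi> \<in> homs C I J"
    and l_compat: "X \<in> Obj C \<Longrightarrow> l' X \<cdot> amap T (\<phi>, \<one> X) = l X"
    and r_compat: "X \<in> Obj C \<Longrightarrow> amap T (\<one> X, \<phi>) \<cdot> r X = r' X"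

text \<open>
  The same \<open>\<phi>\<close> may be a morphism between several pairs of units; since \<^const>\<open>Dom\<close> and
  \<^const>\<open>Cod\<close> are functions of the arrow, an arrow carries its source and target units.
\<close>

type_synonym ('o, 'm) unit_triple = "'o \<times> ('o \<Rightarrow> 'm) \<times> ('o \<Rightarrow> 'm)"

definition units_category ::
  "('o, 'm) cat \<Rightarrow> ('o \<times> 'o, 'm \<times> 'm, 'o, 'm) fctr \<Rightarrow> ('o \<Rightarrow> 'o \<Rightarrow> 'o \<Rightarrow> 'm) \<Rightarrow>
   (('o, 'm) unit_triple, ('o, 'm) unit_triple \<times> 'm \<times> ('o, 'm) unit_triple) cat" where
  "units_category C T \<alpha> =
     \<lparr>Obj = {(I, l, r). skew_unit C T \<alpha> I l r},
      Arr = {((I, l, r), \<phi>, (J, l', r')). unit_morphism C T \<alpha> I l r J l' r' \<phi>},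
      Dom = (\<lambda>(U, \<phi>, V). U),
      Cod = (\<lambda>(U, \<phi>, V). V),
      Ident = (\<lambda>(I, l, r). ((I, l, r), \<one>\<^bsub>C\<^esub> I, (I, l, r))),
      Comp = (\<lambda>(V, \<psi>, W) (U, \<phi>, V'). (U, \<psi> \<cdot>\<^bsub>C\<^esub> \<phi>, W))\<rparr>"

lemma (in category_with_tensor) tensor_in_homs:
  "f \<in> homs C a b \<Longrightarrow> g \<in> homs C c d \<Longrightarrow> f \<boxtimes> g \<in> homs C (a \<otimes> c) (b \<otimes> d)"
  using tensor.amap_in_homs[of "(f,g)" "(a,c)" "(b,d)"] by (auto simp: homs_def prod_cat_def)

lemma (in category_with_tensor) tensor_Comp:
  "f \<in> homs C a b \<Longrightarrow> f' \<in> homs C b b' \<Longrightarrow> g \<in> homs C c d \<Longrightarrow> g' \<in> homs C d d' \<Longrightarrow> (f' \<cdot> f) \<boxtimes> (g' \<cdot> g) = (f' \<boxtimes> g') \<cdot> (f \<boxtimes> g)"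
  using tensor.amap_Comp[of "(f,g)" "(a,c)" "(b,d)" "(f',g')" "(b',d')"] by (auto simp: homs_def prod_cat_def)

lemma (in category_with_tensor) tensor_Ident:
  "x \<in> Obj C \<Longrightarrow> y \<in> Obj C \<Longrightarrow> \<one> x \<boxtimes> \<one> y = \<one> (x \<otimes> y)"
  using tensor.amap_Ident[of "(x,y)"] by (auto simp: prod_cat_def)

lemma (in category_with_tensor) tensor_in_Obj:
  "x \<in> Obj C \<Longrightarrow> y \<in> Obj C \<Longrightarrow> x \<otimes> y \<in> Obj C"
  using tensor.omap_in_Obj[of "(x,y)"] by (auto simp: prod_cat_def)

lemma (in skew_unit) l_in_homs: "X \<in> Obj C \<Longrightarrow> l X \<in> homs C (I \<otimes> X) X"
  using natural_transformation.component_in_homs[OF l_natural] by (auto simp: id_functor_def)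
lemma (in skew_unit) r_in_homs: "X \<in> Obj C \<Longrightarrow> r X \<in> homs C X (X \<otimes> I)"
  using natural_transformation.component_in_homs[OF r_natural] by (auto simp: id_functor_def)

lemma (in skew_unit) Ident_unit_morphism: "unit_morphism C T \<alpha> I l r I l r (\<one> I)"
proof unfold_locales
  show "\<one> I \<in> homs C I I" using unit_in_Obj Ident_in_homs by blast
  fix X assume X: "X \<in> Obj C"
  show "l X \<cdot> amap T (\<one> I, \<one> X) = l X" using Comp_Ident[OF l_in_homs[OF X]] tensor_Ident[OF unit_in_Obj X] by simp
  show "amap T (\<one> X, \<one> I) \<cdot> r X = r X" using Ident_Comp[OF r_in_homs[OF X]] tensor_Ident[OF X unit_in_Obj] by simp
qed

lemma Comp_unit_morphism:
  assumes "unit_morphism C T \<alpha> I l r J l' r' f" "unit_morphism C T \<alpha> J l' r' K l'' r'' g"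
  shows "unit_morphism C T \<alpha> I l r K l'' r'' (g \<cdot>\<^bsub>C\<^esub> f)"
proof -
  interpret f: unit_morphism C T \<alpha> I l r J l' r' f by fact
  interpret g: unit_morphism C T \<alpha> J l' r' K l'' r'' g by fact
  note fh = f.in_homs and gh = g.in_homs
  show ?thesis
  proof unfold_locales
    show "g \<cdot>\<^bsub>C\<^esub> f \<in> homs C I K" using fh gh f.source.Comp_in_homs by blast
    fix X assume X: "X \<in> Obj C"
    note i = f.source.Ident_in_homs[OF X]
    have 1: "amap T (g \<cdot>\<^bsub>C\<^esub> f, \<one>\<^bsub>C\<^esub> X) = amap T (g, \<one>\<^bsub>C\<^esub> X) \<cdot>\<^bsub>C\<^esub> amap T (f, \<one>\<^bsub>C\<^esub> X)"
      using f.source.tensor_Comp[OF fh gh i i] f.source.Comp_Ident[OF i] by simp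
    show "l'' X \<cdot>\<^bsub>C\<^esub> amap T (g \<cdot>\<^bsub>C\<^esub> f, \<one>\<^bsub>C\<^esub> X) = l X"
      unfolding 1 using f.l_compat[OF X] g.l_compat[OF X] 
      using f.source.Comp_assoc[OF f.source.tensor_in_homs[OF fh i] f.source.tensor_in_homs[OF gh i] g.target.l_in_homs[OF X]] by simp
    have 2: "amap T (\<one>\<^bsub>C\<^esub> X, g \<cdot>\<^bsub>C\<^esub> f) = amap T (\<one>\<^bsub>C\<^esub> X, g) \<cdot>\<^bsub>C\<^esub> amap T (\<one>\<^bsub>C\<^esub> X, f)"
      using f.source.tensor_Comp[OF i i fh gh] f.source.Comp_Ident[OF i] by simp
    show "amap T (\<one>\<^bsub>C\<^esub> X, g \<cdot>\<^bsub>C\<^esub> f) \<cdot>\<^bsub>C\<^esub> r X = r'' X"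
      unfolding 2 using f.r_compat[OF X] g.r_compat[OF X] 
      using f.source.Comp_assoc[OF f.source.r_in_homs[OF X] f.source.tensor_in_homs[OF i fh] f.source.tensor_in_homs[OF i gh]] by simp
  qed
qed

lemma units_category_homs_iff: "F \<in> homs (units_category C T \<alpha>) (I,l,r) (J,l',r') \<longleftrightarrow> (\<exists>f. F = ((I,l,r),f,(J,l',r')) \<and> unit_morphism C T \<alpha> I l r J l' r' f)"
  by (auto simp: units_category_def homs_def)

lemma category_units_category: "category (units_category C T \<alpha>)"
proof (unfold_locales, goal_cases)
  case (1 f) then show ?case by (auto simp: units_category_def unit_morphism_def)
next
  case (2 f) then show ?case by (auto simp: units_category_def unit_morphism_def)
next
  case (3 x) then show ?case
    by (cases x) (auto simp: units_category_homs_iff skew_unit.Ident_unit_morphism units_category_def homs_def)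
next
  case (4 f x y g z)
  obtain a b c where x: "x = (a,b,c)" by (cases x)
  obtain a' b' c' where y: "y = (a',b',c')" by (cases y)
  obtain a'' b'' c'' where z: "z = (a'',b'',c'')" by (cases z)
  from 4 show ?case unfolding x y z units_category_homs_iff by (elim exE conjE) (auto simp: units_category_def intro: Comp_unit_morphism)
next
  case (5 f x y)
  obtain a b c where x: "x = (a,b,c)" by (cases x)
  obtain a' b' c' where y: "y = (a',b',c')" by (cases y)
  from 5 obtain \<phi> where f: "f = (x,\<phi>,y)" and u: "unit_morphism C T \<alpha> a b c a' b' c' \<phi>" unfolding x y units_category_homs_iff by blast
  interpret unit_morphism C T \<alpha> a b c a' b' c' \<phi> by fact
  show ?case using source.Comp_Ident[OF in_homs] by (simp add: f x y units_category_def)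
next
  case (6 f x y)
  obtain a b c where x: "x = (a,b,c)" by (cases x)
  obtain a' b' c' where y: "y = (a',b',c')" by (cases y)
  from 6 obtain \<phi> where f: "f = (x,\<phi>,y)" and u: "unit_morphism C T \<alpha> a b c a' b' c' \<phi>" unfolding x y units_category_homs_iff by blast
  interpret unit_morphism C T \<alpha> a b c a' b' c' \<phi> by fact
  show ?case using source.Ident_Comp[OF in_homs] by (simp add: f x y units_category_def)
next
  case (7 f w x g y h z)
  obtain d1 d2 d3 where w: "w = (d1,d2,d3)" by (cases w)
  obtain a b c where x: "x = (a,b,c)" by (cases x)
  obtain a' b' c' where y: "y = (a',b',c')" by (cases y)
  obtain a'' b'' c'' where z: "z = (a'',b'',c'')" by (cases z)
  from 7 obtain f1 g1 h1 where e: "f = (w,f1,x)" "g = (x,g1,y)" "h = (y,h1,z)"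
    and u: "unit_morphism C T \<alpha> d1 d2 d3 a b c f1" "unit_morphism C T \<alpha> a b c a' b' c' g1" "unit_morphism C T \<alpha> a' b' c' a'' b'' c'' h1"
    unfolding w x y z units_category_homs_iff by blast
  interpret f: unit_morphism C T \<alpha> d1 d2 d3 a b c f1 by fact
  interpret g: unit_morphism C T \<alpha> a b c a' b' c' g1 by fact
  interpret h: unit_morphism C T \<alpha> a' b' c' a'' b'' c'' h1 by fact
  show ?case using f.source.Comp_assoc[OF f.in_homs g.in_homs h.in_homs]
    by (simp add: e w x y z units_category_def)
qed

end

theory Submission imports Defs begin

text \<open>
  Any two units are joined by exactly one morphism of units, so the category of units is
  indiscrete (every hom-set is a singleton) and all its objects are isomorphic.

  For units \<open>(I, \<lambda>, \<rho>)\<close> and \<open>(J, \<lambda>', \<rho>')\<close> the morphism is the composite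
  \<open>I \<rightarrow> I \<otimes> J \<rightarrow> J\<close> of \<open>\<rho>'\<close> at \<open>I\<close> and \<open>\<lambda>\<close> at \<open>J\<close>. It is compatible with the unit
  constraints because each compatibility collapses, by naturality and one of the laws for
  \<open>X \<otimes> Y\<close>, to a triangle law: that of \<open>J\<close> for the left constraints, that of \<open>I\<close> for the right
  ones. It is the only morphism because a morphism \<open>\<phi>\<close> of units satisfies
  \<open>\<phi> = \<phi> \<circ> \<lambda>\<^sub>I \<circ> \<rho>\<^sub>I = \<lambda>\<^sub>J \<circ> (1\<^sub>I \<otimes> \<phi>) \<circ> \<rho>\<^sub>I = \<lambda>\<^sub>J \<circ> \<rho>'\<^sub>I\<close>, the last expression
  not involving \<open>\<phi>\<close>. Uniqueness, applied to endomorphisms, makes the canonical morphisms in the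
  two directions mutually inverse.
\<close>

lemma (in skew_semimonoidal_category) associator_in_homs:
  "\<lbrakk>X \<in> Obj C; Y \<in> Obj C; Z \<in> Obj C\<rbrakk> \<Longrightarrow> \<alpha> X Y Z \<in> homs C ((X \<otimes> Y) \<otimes> Z) (X \<otimes> (Y \<otimes> Z))"
  using natural_transformation.component_in_homs[OF associator_natural, of "((X, Y), Z)"]
  by (simp add: prod_cat_def)

lemma (in skew_unit) l_naturality: "f \<in> homs C X Y \<Longrightarrow> l Y \<cdot> (\<one> I \<boxtimes> f) = f \<cdot> l X"
  using natural_transformation.naturality[OF l_natural] by (simp add: id_functor_def)

lemma (in skew_unit) r_naturality: "f \<in> homs C X Y \<Longrightarrow> r Y \<cdot> f = (f \<boxtimes> \<one> I) \<cdot> r X"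
  using natural_transformation.naturality[OF r_natural] by (simp add: id_functor_def)

locale skew_unit_pair =
  source: skew_unit C T \<alpha> I l r + target: skew_unit C T \<alpha> J l' r'
  for C :: "('o, 'm) cat" (structure)
    and T :: "('o \<times> 'o, 'm \<times> 'm, 'o, 'm) fctr"
    and \<alpha> :: "'o \<Rightarrow> 'o \<Rightarrow> 'o \<Rightarrow> 'm"
    and I :: 'o and l r :: "'o \<Rightarrow> 'm" and J :: 'o and l' r' :: "'o \<Rightarrow> 'm"
begin

lemma comparison_in_homs: "l J \<cdot> r' I \<in> homs C I J"
  using source.Comp_in_homs target.r_in_homs source.l_in_homs source.unit_in_Obj target.unit_in_Obj
  by blast

text \<open>
  The law for \<open>\<lambda>\<close> at \<open>J \<otimes> X\<close> brings in the associator, and naturality of \<open>\<lambda>\<close> moves \<open>\<lambda>'\<^sub>X\<close> inside;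
  what is left to the right of \<open>\<lambda>\<^sub>X\<close> is the triangle law of \<open>J\<close> at \<open>I\<close> and \<open>X\<close>.
\<close>

lemma comparison_l_compat:
  assumes X: "X \<in> Obj C"
  shows "l' X \<cdot> ((l J \<cdot> r' I) \<boxtimes> \<one> X) = l X"
proof -
  note I = source.unit_in_Obj and J = target.unit_in_Obj
  note idX = source.Ident_in_homs[OF X]
  have r'_tensor: "r' I \<boxtimes> \<one> X \<in> homs C (I \<otimes> X) ((I \<otimes> J) \<otimes> X)"
    by (rule source.tensor_in_homs[OF target.r_in_homs[OF I] idX])
  have assoc: "\<alpha> I J X \<in> homs C ((I \<otimes> J) \<otimes> X) (I \<otimes> (J \<otimes> X))"
    by (rule source.associator_in_homs[OF I J X])
  have assoc_r': "\<alpha> I J X \<cdot> (r' I \<boxtimes> \<one> X) \<in> homs C (I \<otimes> X) (I \<otimes> (J \<otimes> X))"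
    by (rule source.Comp_in_homs[OF r'_tensor assoc])
  have l_JX: "l (J \<otimes> X) \<in> homs C (I \<otimes> (J \<otimes> X)) (J \<otimes> X)"
    by (rule source.l_in_homs[OF source.tensor_in_Obj[OF J X]])
  have l'_X: "l' X \<in> homs C (J \<otimes> X) X"
    by (rule target.l_in_homs[OF X])
  have tensor_l': "\<one> I \<boxtimes> l' X \<in> homs C (I \<otimes> (J \<otimes> X)) (I \<otimes> X)"
    by (rule source.tensor_in_homs[OF source.Ident_in_homs[OF I] l'_X])
  have "(l J \<cdot> r' I) \<boxtimes> \<one> X = (l J \<boxtimes> \<one> X) \<cdot> (r' I \<boxtimes> \<one> X)"
    using source.tensor_Comp[OF target.r_in_homs[OF I] source.l_in_homs[OF J] idX idX]
    by (simp add: source.Comp_Ident[OF idX])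
  also have "\<dots> = l (J \<otimes> X) \<cdot> (\<alpha> I J X \<cdot> (r' I \<boxtimes> \<one> X))"
    using source.l_tensor[OF J X] source.Comp_assoc[OF r'_tensor assoc l_JX] by simp
  finally have "l' X \<cdot> ((l J \<cdot> r' I) \<boxtimes> \<one> X)
      = (l' X \<cdot> l (J \<otimes> X)) \<cdot> (\<alpha> I J X \<cdot> (r' I \<boxtimes> \<one> X))"
    using source.Comp_assoc[OF assoc_r' l_JX l'_X] by simp
  also have "\<dots> = l X \<cdot> ((\<one> I \<boxtimes> l' X) \<cdot> (\<alpha> I J X \<cdot> (r' I \<boxtimes> \<one> X)))"
    using source.l_naturality[OF l'_X]
      source.Comp_assoc[OF assoc_r' tensor_l' source.l_in_homs[OF X]] by simp
  also have "\<dots> = l X \<cdot> \<one> (I \<otimes> X)"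
    using target.triangle[OF I X] source.Comp_assoc[OF r'_tensor assoc tensor_l'] by simp
  also have "\<dots> = l X"
    by (rule source.Comp_Ident[OF source.l_in_homs[OF X]])
  finally show ?thesis .
qed

text \<open>
  Dually, the law for \<open>\<rho>'\<close> at \<open>X \<otimes> I\<close> brings in the associator, and naturality of \<open>\<rho>'\<close> moves \<open>\<rho>\<^sub>X\<close>
  to its other side; what is left to the left of \<open>\<rho>'\<^sub>X\<close> is the triangle law of \<open>I\<close> at \<open>X\<close> and \<open>J\<close>.
\<close>

lemma comparison_r_compat:
  assumes X: "X \<in> Obj C"
  shows "(\<one> X \<boxtimes> (l J \<cdot> r' I)) \<cdot> r X = r' X"
proof -
  note I = source.unit_in_Obj and J = target.unit_in_Obj
  note idX = source.Ident_in_homs[OF X]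
  have tensor_l: "\<one> X \<boxtimes> l J \<in> homs C (X \<otimes> (I \<otimes> J)) (X \<otimes> J)"
    by (rule source.tensor_in_homs[OF idX source.l_in_homs[OF J]])
  have assoc: "\<alpha> X I J \<in> homs C ((X \<otimes> I) \<otimes> J) (X \<otimes> (I \<otimes> J))"
    by (rule source.associator_in_homs[OF X I J])
  have l_assoc: "(\<one> X \<boxtimes> l J) \<cdot> \<alpha> X I J \<in> homs C ((X \<otimes> I) \<otimes> J) (X \<otimes> J)"
    by (rule source.Comp_in_homs[OF assoc tensor_l])
  have r'_XI: "r' (X \<otimes> I) \<in> homs C (X \<otimes> I) ((X \<otimes> I) \<otimes> J)"
    by (rule target.r_in_homs[OF source.tensor_in_Obj[OF X I]])
  have r_X: "r X \<in> homs C X (X \<otimes> I)"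
    by (rule source.r_in_homs[OF X])
  have r_tensor: "r X \<boxtimes> \<one> J \<in> homs C (X \<otimes> J) ((X \<otimes> I) \<otimes> J)"
    by (rule source.tensor_in_homs[OF r_X source.Ident_in_homs[OF J]])
  have "\<one> X \<boxtimes> (l J \<cdot> r' I) = (\<one> X \<boxtimes> l J) \<cdot> (\<one> X \<boxtimes> r' I)"
    using source.tensor_Comp[OF idX idX target.r_in_homs[OF I] source.l_in_homs[OF J]]
    by (simp add: source.Comp_Ident[OF idX])
  also have "\<dots> = ((\<one> X \<boxtimes> l J) \<cdot> \<alpha> X I J) \<cdot> r' (X \<otimes> I)"
    using target.r_tensor[OF X I] source.Comp_assoc[OF r'_XI assoc tensor_l] by simp
  finally have "(\<one> X \<boxtimes> (l J \<cdot> r' I)) \<cdot> r X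
      = ((\<one> X \<boxtimes> l J) \<cdot> \<alpha> X I J) \<cdot> (r' (X \<otimes> I) \<cdot> r X)"
    using source.Comp_assoc[OF r_X r'_XI l_assoc] by simp
  also have "\<dots> = (((\<one> X \<boxtimes> l J) \<cdot> \<alpha> X I J) \<cdot> (r X \<boxtimes> \<one> J)) \<cdot> r' X"
    using target.r_naturality[OF r_X]
      source.Comp_assoc[OF target.r_in_homs[OF X] r_tensor l_assoc] by simp
  also have "\<dots> = \<one> (X \<otimes> J) \<cdot> r' X"
    using source.triangle[OF X J] by simp
  also have "\<dots> = r' X"
    by (rule source.Ident_Comp[OF target.r_in_homs[OF X]])
  finally show ?thesis .
qed

lemma comparison_unit_morphism: "unit_morphism C T \<alpha> I l r J l' r' (l J \<cdot> r' I)"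
  by unfold_locales (fact comparison_in_homs comparison_l_compat comparison_r_compat)+

end

text \<open>
  The law \<open>\<lambda>\<^sub>I \<circ> \<rho>\<^sub>I = 1\<^sub>I\<close> lets \<open>\<phi>\<close> be rewritten as \<open>\<phi> \<circ> \<lambda>\<^sub>I \<circ> \<rho>\<^sub>I\<close>; naturality of \<open>\<lambda>\<close> then
  places \<open>\<phi>\<close> where its compatibility with the right constraints absorbs it.
\<close>

lemma (in unit_morphism) eq_comparison: "\<phi> = l J \<cdot> r' I"
proof -
  note I = source.unit_in_Obj and J = target.unit_in_Obj
  have "\<phi> = \<phi> \<cdot> (l I \<cdot> r I)"
    by (simp add: source.l_r_unit source.Comp_Ident[OF in_homs])
  also have "\<dots> = (\<phi> \<cdot> l I) \<cdot> r I"
    using source.Comp_assoc[OF source.r_in_homs[OF I] source.l_in_homs[OF I] in_homs] by simp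
  also have "\<dots> = (l J \<cdot> (\<one> I \<boxtimes> \<phi>)) \<cdot> r I"
    by (simp add: source.l_naturality[OF in_homs])
  also have "\<dots> = l J \<cdot> ((\<one> I \<boxtimes> \<phi>) \<cdot> r I)"
    by (rule source.Comp_assoc[OF source.r_in_homs[OF I]
          source.tensor_in_homs[OF source.Ident_in_homs[OF I] in_homs] source.l_in_homs[OF J]])
  also have "\<dots> = l J \<cdot> r' I"
    by (simp add: r_compat[OF I])
  finally show ?thesis .
qed

lemma unit_morphism_unique:
  "\<lbrakk>unit_morphism C T \<alpha> I l r J l' r' \<phi>; unit_morphism C T \<alpha> I l r J l' r' \<psi>\<rbrakk> \<Longrightarrow> \<phi> = \<psi>"
  using unit_morphism.eq_comparison by metis

theorem corollary2p3:
  fixes C :: "('o, 'm) cat"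
    and T :: "('o \<times> 'o, 'm \<times> 'm, 'o, 'm) fctr"
    and \<alpha> :: "'o \<Rightarrow> 'o \<Rightarrow> 'o \<Rightarrow> 'm"
    and I J :: 'o and l r l' r' :: "'o \<Rightarrow> 'm"
  assumes "skew_semimonoidal_category C T \<alpha>"
    and "(I, l, r) \<in> Obj (units_category C T \<alpha>)"
    and "(J, l', r') \<in> Obj (units_category C T \<alpha>)"
  shows "isomorphic_in (units_category C T \<alpha>) (I, l, r) (J, l', r')"
proof -
  have I: "skew_unit C T \<alpha> I l r" and J: "skew_unit C T \<alpha> J l' r'"
    using assms by (auto simp: units_category_def)
  obtain \<phi> where \<phi>: "unit_morphism C T \<alpha> I l r J l' r' \<phi>"
    using skew_unit_pair.comparison_unit_morphism[OF skew_unit_pair.intro[OF I J]] ..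
  obtain \<psi> where \<psi>: "unit_morphism C T \<alpha> J l' r' I l r \<psi>"
    using skew_unit_pair.comparison_unit_morphism[OF skew_unit_pair.intro[OF J I]] ..
  have "\<psi> \<cdot>\<^bsub>C\<^esub> \<phi> = \<one>\<^bsub>C\<^esub> I"
    by (rule unit_morphism_unique[OF Comp_unit_morphism[OF \<phi> \<psi>] skew_unit.Ident_unit_morphism[OF I]])
  moreover have "\<phi> \<cdot>\<^bsub>C\<^esub> \<psi> = \<one>\<^bsub>C\<^esub> J"
    by (rule unit_morphism_unique[OF Comp_unit_morphism[OF \<psi> \<phi>] skew_unit.Ident_unit_morphism[OF J]])
  ultimately show ?thesis
    unfolding isomorphic_in_def
    by (intro bexI[of _ "((I, l, r), \<phi>, (J, l', r'))"] bexI[of _ "((J, l', r'), \<psi>, (I, l, r))"])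
      (use \<phi> \<psi> in \<open>simp_all add: units_category_homs_iff\<close>, simp_all add: units_category_def)
qed

end
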